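(* Let $\mathscr{T}=(V,E)$ be a countably infinite rooted and leafless directed tree, $\boldsymbol\lambda=\{\lambda_v\}_{v\in V^\circ}\subseteq(0,\infty)$ and let $S_{\boldsymbol\lambda}\in\mathbf{B}(\ell^2(V))$ be a left-invertible weighted shift on $\mathscr{T}$ with weights $\boldsymbol\lambda$. Let $\{a_n\}_{n=0}^\infty\subset\mathbb{C}$. Define $\hat\varphi\colon\mathbb{N}_0\to\mathbb{C}$ by $\hat\varphi(n)=a_n$ and $\hat\psi\colon\mathbb{N}_0\to\mathbf{B}(\ker S_{\boldsymbol\lambda}^* )$ by $\hat\psi(n)=a_nI_{\ker S_{\boldsymbol\lambda}^*}$ for $n\in\mathbb{N}_0$. Then $\hat\varphi$ is a multiplier for $S_{\boldsymbol\lambda}$ if and only if $\hat\psi$ is a generalized multiplier for $S_{\boldsymbol\lambda}$. Moreover, if these conditions are met, then $M_{\hat\varphi}^{\boldsymbol\lambda}=U^*M_{\hat\psi}U$.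
   Context: $\mathbb{N}_0=\{0,1,2,\dots\}$. A rooted directed tree $\mathscr{T}=(V,E)$ has a unique vertex $\mathsf{root}$ without parent; every other vertex $v$ has a unique parent $\mathsf{par}(v)$; $V^\circ=V\setminus\{\mathsf{root}\}$; $\mathsf{par}^k$ is the $k$-fold composition of $\mathsf{par}$; $|v|$ is the unique $k\in\mathbb{N}_0$ with $\mathsf{par}^k(v)=\mathsf{root}$. The tree is leafless if every vertex has at least one child. $\ell^2(V)$ is the space of square-summable functions $V\to\mathbb{C}$. The weighted shift $S_{\boldsymbol\lambda}$ with weights $\boldsymbol\lambda$ is the operator in $\ell^2(V)$ given by $(S_{\boldsymbol\lambda}f)(v)=\lambda_vf(\mathsf{par}(v))$ for $v\in V^\circ$ and $(S_{\boldsymbol\lambda}f)(\mathsf{root})=0$, on its maximal domain; $\mathbf{B}(\cdot)$ denotes bounded everywhere defined operators. Bounded weighted shifts on rooted directed trees are analytic ($\bigcap_n S_{\boldsymbol\lambda}^n(\ell^2(V))=\{0\}$). Left-invertible means having a bounded left inverse. Multipliers: for $v\in V$ and $0\le k\le|v|$ put $\lambda_{\mathsf{par}^k(v)|v}=\prod_{n=0}^{k-1}\lambda_{\mathsf{par}^n(v)}$ (empty product $=1$). For $\hat\varphi\colon\mathbb{N}_0\to\mathbb{C}$, $M^{\boldsymbol\lambda}_{\hat\varphi}$ is the operator in $\ell^2(V)$ defined by $(M^{\boldsymbol\lambda}_{\hat\varphi}f)(v)=\sum_{k=0}^{|v|}\lambda_{\mathsf{par}^k(v)|v}\,\hat\varphi(k)f(\mathsf{par}^k(v))$,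 with domain the set of $f\in\ell^2(V)$ for which the right-hand side is in $\ell^2(V)$. $\hat\varphi$ is a multiplier for $S_{\boldsymbol\lambda}$ if this domain is all of $\ell^2(V)$. Generalized multipliers: put $T=S_{\boldsymbol\lambda}$, $H=\ell^2(V)$, $\mathcal{E}=\ker T^*$, $P_{\mathcal{E}}$ the orthogonal projection onto $\mathcal{E}$, $L=(T^*T)^{-1}T^*$, $r=1/r(L)$ ($r(L)$ the spectral radius), $\mathbb{D}_r=\{|z|<r\}$. For $f\in H$ let $(Uf)(z)=\sum_{n=0}^\infty(P_{\mathcal{E}}L^nf)z^n$, $z\in\mathbb{D}_r$; $U$ is injective, and $\mathcal{H}:=U(H)$ is a space of $\mathcal{E}$-valued analytic functions on $\mathbb{D}_r$ with the inner product making $U\colon H\to\mathcal{H}$ unitary. For $\boldsymbol f\in\mathcal{H}$, $\hat{\boldsymbol f}(n)=P_{\mathcal{E}}L^nU^*\boldsymbol f$ are its Taylor coefficients. For $\hat\psi\colon\mathbb{N}_0\to\mathbf{B}(\mathcal{E})$, $M_{\hat\psi}$ has domain consisting of $\boldsymbol f\in\mathcal{H}$ for which there is $\boldsymbol g\in\mathcal{H}$ with $\hat{\boldsymbol g}(n)=\sum_{k=0}^n\hat\psi(k)\hat{\boldsymbol f}(n-k)$ for all $n\in\mathbb{N}_0$, and $M_{\hat\psi}\boldsymbol f=\boldsymbol g$. $\hat\psi$ is a generalized multiplier for $S_{\boldsymbol\lambda}$ if the domain of $M_{\hat\psi}$ is all of $\mathcal{H}$. *)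

theory Defs
  imports "HOL-Analysis.Analysis"
begin

typedef 'v ell2 = "{f :: 'v \<Rightarrow> complex. (\<lambda>v. (cmod (f v))\<^sup>2) summable_on UNIV}"
  by (rule exI[of _ "\<lambda>_. 0"]) simp

setup_lifting type_definition_ell2

abbreviation square_summable :: "('v \<Rightarrow> complex) \<Rightarrow> bool" where
  "square_summable f \<equiv> (\<lambda>v. (cmod (f v))\<^sup>2) summable_on UNIV"

lemma square_summable_add:
  assumes "square_summable f" "square_summable g"
  shows "square_summable (\<lambda>v. f v + g v)"
proof (rule summable_on_comparison_test)
  show "(\<lambda>v. 2 * (cmod (f v))\<^sup>2 + 2 * (cmod (g v))\<^sup>2) summable_on UNIV"
    using assms by (intro summable_on_add summable_on_cmult_right)
  fix v
  have "(cmod (f v + g v))\<^sup>2 \<le> (cmod (f v) + cmod (g v))\<^sup>2"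
    by (intro power_mono norm_triangle_ineq) simp
  also have "\<dots> \<le> 2 * (cmod (f v))\<^sup>2 + 2 * (cmod (g v))\<^sup>2"
    using sum_squares_bound[of "cmod (f v)" "cmod (g v)"] by (simp add: power2_sum)
  finally show "(cmod (f v + g v))\<^sup>2 \<le> 2 * (cmod (f v))\<^sup>2 + 2 * (cmod (g v))\<^sup>2" .
qed simp

lemma square_summable_mult:
  "square_summable f \<Longrightarrow> square_summable (\<lambda>v. c * f v)"
  by (simp add: norm_mult power_mult_distrib summable_on_cmult_right)

lemma square_summable_diff:
  assumes "square_summable f" "square_summable g"
  shows "square_summable (\<lambda>v. f v - g v)"
  using square_summable_add[of f "\<lambda>v. - g v"] assms by simp

lemma square_summable_product:
  assumes "square_summable f" "square_summable g"
  shows "(\<lambda>v. f v * cnj (g v)) summable_on UNIV"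
proof -
  have "(\<lambda>v. norm (f v * cnj (g v))) summable_on UNIV"
    by (rule abs_summable_product) (use assms in \<open>simp_all add: power2_eq_square norm_mult\<close>)
  then show ?thesis by (rule abs_summable_summable)
qed

lift_definition scaleC :: "complex \<Rightarrow> 'v ell2 \<Rightarrow> 'v ell2" (infixr "*\<^sub>C" 75)
  is "\<lambda>c f v. c * f v"
  by (simp add: square_summable_mult)

lift_definition cinner :: "'v ell2 \<Rightarrow> 'v ell2 \<Rightarrow> complex"
  is "\<lambda>f g. \<Sum>\<^sub>\<infinity>v. f v * cnj (g v)" .

instantiation ell2 :: (type) real_inner
begin

lift_definition zero_ell2 :: "'a ell2" is "\<lambda>_. 0" by simp

lift_definition plus_ell2 :: "'a ell2 \<Rightarrow> 'a ell2 \<Rightarrow> 'a ell2" is "\<lambda>f g v. f v + g v"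
  by (simp add: square_summable_add)

lift_definition uminus_ell2 :: "'a ell2 \<Rightarrow> 'a ell2" is "\<lambda>f v. - f v" by simp

lift_definition minus_ell2 :: "'a ell2 \<Rightarrow> 'a ell2 \<Rightarrow> 'a ell2" is "\<lambda>f g v. f v - g v"
  by (simp add: square_summable_diff)

definition scaleR_ell2 :: "real \<Rightarrow> 'a ell2 \<Rightarrow> 'a ell2" where
  "scaleR_ell2 r f = complex_of_real r *\<^sub>C f"

definition inner_ell2 :: "'a ell2 \<Rightarrow> 'a ell2 \<Rightarrow> real" where
  "inner_ell2 f g = Re (cinner f g)"

definition norm_ell2 :: "'a ell2 \<Rightarrow> real" where
  "norm_ell2 f = sqrt (inner f f)"

definition sgn_ell2 :: "'a ell2 \<Rightarrow> 'a ell2" where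
  "sgn_ell2 f = scaleR (inverse (norm f)) f"

definition dist_ell2 :: "'a ell2 \<Rightarrow> 'a ell2 \<Rightarrow> real" where
  "dist_ell2 f g = norm (f - g)"

definition uniformity_ell2 :: "('a ell2 \<times> 'a ell2) filter" where
  "uniformity_ell2 = (INF e\<in>{0 <..}. principal {(x, y). dist x y < e})"

definition open_ell2 :: "'a ell2 set \<Rightarrow> bool" where
  "open_ell2 S = (\<forall>x\<in>S. \<forall>\<^sub>F (x', y) in uniformity. x' = x \<longrightarrow> y \<in> S)"

lemma inner_ell2_self: "inner f f = (\<Sum>\<^sub>\<infinity>v. (cmod (Rep_ell2 f v))\<^sup>2)" for f :: "'a ell2"
  using Rep_ell2[of f]
  by (simp add: inner_ell2_def cinner.rep_eq square_summable_product cmod_power2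
      flip: infsum_Re power2_eq_square)

instance
proof
  fix x y z :: "'a ell2" and a b r :: real
  show "x + y + z = x + (y + z)" "x + y = y + x" "0 + x = x" "- x + x = 0" "x - y = x + - y"
    by (transfer; simp add: fun_eq_iff add_ac)+
  show "a *\<^sub>R (x + y) = a *\<^sub>R x + a *\<^sub>R y" "(a + b) *\<^sub>R x = a *\<^sub>R x + b *\<^sub>R x"
    "a *\<^sub>R b *\<^sub>R x = (a * b) *\<^sub>R x" "1 *\<^sub>R x = x"
    unfolding scaleR_ell2_def by (transfer; simp add: fun_eq_iff algebra_simps)+
  show "sgn x = inverse (norm x) *\<^sub>R x" by (rule sgn_ell2_def)
  show "dist x y = norm (x - y)" by (rule dist_ell2_def)
  show "uniformity = (INF e\<in>{0 <..}. principal {(x :: 'a ell2, y). dist x y < e})"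
    by (rule uniformity_ell2_def)
  show "open U = (\<forall>x\<in>U. \<forall>\<^sub>F (x', y) in uniformity. x' = x \<longrightarrow> y \<in> U)" for U :: "'a ell2 set"
    by (rule open_ell2_def)
  show "inner x y = inner y x"
  proof -
    have "cinner y x = cnj (cinner x y)"
      by (simp add: cinner.rep_eq mult.commute flip: infsum_cnj)
    then show ?thesis by (simp add: inner_ell2_def)
  qed
  show "inner (x + y) z = inner x z + inner y z"
    unfolding inner_ell2_def
    by transfer (simp add: distrib_right infsum_add square_summable_product)
  show "inner (r *\<^sub>R x) y = r * inner x y"
    unfolding inner_ell2_def scaleR_ell2_def
    by transfer (simp add: mult.assoc infsum_cmult_right')
  show "0 \<le> inner x x"
    unfolding inner_ell2_self by (rule infsum_nonneg) simp
  show "inner x x = 0 \<longleftrightarrow> x = 0"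
  proof
    assume "inner x x = 0"
    then have "(cmod (Rep_ell2 x v))\<^sup>2 = 0" for v
      unfolding inner_ell2_self
      by (intro nonneg_infsum_le_0D[where A = UNIV]) (use Rep_ell2[of x] in auto)
    then show "x = 0" by (simp add: zero_ell2.rep_eq fun_eq_iff flip: Rep_ell2_inject)
  qed (simp add: inner_ell2_self zero_ell2.rep_eq)
  show "norm x = sqrt (inner x x)" by (rule norm_ell2_def)
qed

end

lemma norm_ell2_sq: "(norm f)\<^sup>2 = (\<Sum>\<^sub>\<infinity>v. (cmod (Rep_ell2 f v))\<^sup>2)"
  using power2_norm_eq_inner[of f] inner_ell2_self[of f] by simp

lemma finite_sum_le_norm_ell2:
  "finite F \<Longrightarrow> (\<Sum>v\<in>F. (cmod (Rep_ell2 f v))\<^sup>2) \<le> (norm f)\<^sup>2"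
  unfolding norm_ell2_sq by (rule finite_sum_le_infsum) (use Rep_ell2[of f] in auto)

lemma cmod_le_norm_ell2: "cmod (Rep_ell2 f v) \<le> norm f"
  using finite_sum_le_norm_ell2[of "{v}" f] by (simp add: power2_le_iff_abs_le)

instance ell2 :: (type) banach
proof
  fix X :: "nat \<Rightarrow> 'a ell2"
  assume X: "Cauchy X"
  have "Cauchy (\<lambda>n. Rep_ell2 (X n) v)" for v
  proof (rule metric_CauchyI)
    fix e :: real assume "e > 0"
    then obtain N where "\<forall>m\<ge>N. \<forall>n\<ge>N. dist (X m) (X n) < e"
      using metric_CauchyD[OF X] by blast
    moreover have "dist (Rep_ell2 (X m) v) (Rep_ell2 (X n) v) \<le> dist (X m) (X n)" for m n
      using cmod_le_norm_ell2[of "X m - X n" v] by (simp add: dist_norm minus_ell2.rep_eq)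
    ultimately show "\<exists>N. \<forall>m\<ge>N. \<forall>n\<ge>N. dist (Rep_ell2 (X m) v) (Rep_ell2 (X n) v) < e"
      by (meson le_less_trans)
  qed
  then have "\<forall>v. \<exists>l. (\<lambda>n. Rep_ell2 (X n) v) \<longlonglongrightarrow> l"
    by (simp add: Cauchy_convergent_iff convergent_def)
  then obtain f where f: "(\<lambda>n. Rep_ell2 (X n) v) \<longlonglongrightarrow> f v" for v
    by metis
  have bound: "\<exists>N. \<forall>m\<ge>N. \<forall>F. finite F \<longrightarrow> (\<Sum>v\<in>F. (cmod (Rep_ell2 (X m) v - f v))\<^sup>2) \<le> e\<^sup>2"
    if "e > 0" for e
  proof -
    obtain N where N: "dist (X m) (X n) < e" if "m \<ge> N" "n \<ge> N" for m n
      using metric_CauchyD[OF X \<open>e > 0\<close>] by blast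
    have "(\<Sum>v\<in>F. (cmod (Rep_ell2 (X m) v - f v))\<^sup>2) \<le> e\<^sup>2" if "m \<ge> N" "finite F" for m F
    proof (rule LIMSEQ_le_const2)
      show "(\<lambda>n. \<Sum>v\<in>F. (cmod (Rep_ell2 (X m) v - Rep_ell2 (X n) v))\<^sup>2)
          \<longlonglongrightarrow> (\<Sum>v\<in>F. (cmod (Rep_ell2 (X m) v - f v))\<^sup>2)"
        by (intro tendsto_intros f)
      have "(\<Sum>v\<in>F. (cmod (Rep_ell2 (X m) v - Rep_ell2 (X n) v))\<^sup>2) \<le> e\<^sup>2" if "n \<ge> N" for n
      proof -
        have "(\<Sum>v\<in>F. (cmod (Rep_ell2 (X m) v - Rep_ell2 (X n) v))\<^sup>2) \<le> (norm (X m - X n))\<^sup>2"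
          using finite_sum_le_norm_ell2[OF \<open>finite F\<close>, of "X m - X n"]
          by (simp add: minus_ell2.rep_eq)
        also have "\<dots> \<le> e\<^sup>2"
          using N[OF \<open>m \<ge> N\<close> that] by (intro power_mono) (simp_all add: dist_norm)
        finally show ?thesis .
      qed
      then show "\<exists>N. \<forall>n\<ge>N. (\<Sum>v\<in>F. (cmod (Rep_ell2 (X m) v - Rep_ell2 (X n) v))\<^sup>2) \<le> e\<^sup>2"
        by blast
    qed
    then show ?thesis by blast
  qed
  obtain N where N: "\<forall>F. finite F \<longrightarrow> (\<Sum>v\<in>F. (cmod (Rep_ell2 (X N) v - f v))\<^sup>2) \<le> 1\<^sup>2"
    using bound[of 1] by auto
  then have "square_summable (\<lambda>v. Rep_ell2 (X N) v - f v)"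
    by (intro nonneg_bdd_above_summable_on bdd_aboveI2[where M = 1]) auto
  then have "square_summable (\<lambda>v. Rep_ell2 (X N) v + - (Rep_ell2 (X N) v - f v))"
    using Rep_ell2[of "X N"]
    by (intro square_summable_add) (simp_all add: norm_minus_commute)
  then have f_Rep: "Rep_ell2 (Abs_ell2 f) = f"
    by (simp add: Abs_ell2_inverse)
  have "X \<longlonglongrightarrow> Abs_ell2 f"
  proof (rule metric_LIMSEQ_I)
    fix e :: real assume "e > 0"
    then obtain N where N: "(\<Sum>v\<in>F. (cmod (Rep_ell2 (X m) v - f v))\<^sup>2) \<le> (e/2)\<^sup>2"
      if "m \<ge> N" "finite F" for m F
      using bound[of "e/2"] by auto
    have "dist (X m) (Abs_ell2 f) < e" if "m \<ge> N" for m
    proof -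
      have "square_summable (\<lambda>v. Rep_ell2 (X m) v - f v)"
        using Rep_ell2[of "X m - Abs_ell2 f"] by (simp add: minus_ell2.rep_eq f_Rep)
      then have "(\<Sum>\<^sub>\<infinity>v. (cmod (Rep_ell2 (X m) v - f v))\<^sup>2) \<le> (e/2)\<^sup>2"
        by (rule infsum_le_finite_sums) (rule N[OF that])
      then have "(norm (X m - Abs_ell2 f))\<^sup>2 \<le> (e/2)\<^sup>2"
        using norm_ell2_sq[of "X m - Abs_ell2 f"] unfolding minus_ell2.rep_eq f_Rep by linarith
      then have "norm (X m - Abs_ell2 f) \<le> e/2"
        by (rule power2_le_imp_le) (use \<open>e > 0\<close> in simp)
      then show ?thesis using \<open>e > 0\<close> by (simp add: dist_norm)
    qed
    then show "\<exists>N. \<forall>m\<ge>N. dist (X m) (Abs_ell2 f) < e" by blast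
  qed
  then show "convergent X" by (auto simp: convergent_def)
qed

definition bounded_clinear :: "('v ell2 \<Rightarrow> 'v ell2) \<Rightarrow> bool" where
  "bounded_clinear T \<longleftrightarrow> bounded_linear T \<and> (\<forall>c f. T (c *\<^sub>C f) = c *\<^sub>C T f)"

definition left_invertible :: "('v ell2 \<Rightarrow> 'v ell2) \<Rightarrow> bool" where
  "left_invertible T \<longleftrightarrow> (\<exists>L. bounded_clinear L \<and> L \<circ> T = id)"

definition cadjoint :: "('v ell2 \<Rightarrow> 'v ell2) \<Rightarrow> 'v ell2 \<Rightarrow> 'v ell2" where
  "cadjoint T = (THE S. \<forall>f g. cinner (T f) g = cinner f (S g))"

definition ker :: "('v ell2 \<Rightarrow> 'v ell2) \<Rightarrow> 'v ell2 set" where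
  "ker T = {f. T f = 0}"

definition orth_proj :: "'v ell2 set \<Rightarrow> 'v ell2 \<Rightarrow> 'v ell2" where
  "orth_proj E f = (THE p. p \<in> E \<and> (\<forall>e\<in>E. cinner (f - p) e = 0))"

definition spectrum :: "('v ell2 \<Rightarrow> 'v ell2) \<Rightarrow> complex set" where
  "spectrum T = {z. \<not> (\<exists>R. bounded_clinear R \<and>
     R \<circ> (\<lambda>f. T f - z *\<^sub>C f) = id \<and> (\<lambda>f. T f - z *\<^sub>C f) \<circ> R = id)}"

definition spectral_radius :: "('v ell2 \<Rightarrow> 'v ell2) \<Rightarrow> real" where
  "spectral_radius T = (SUP z\<in>spectrum T. cmod z)"

text \<open>Operators on the subspace \<open>E\<close> take the value \<^const>\<open>undefined\<close> off \<open>E\<close>.\<close>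

definition bounded_operators :: "'v ell2 set \<Rightarrow> ('v ell2 \<Rightarrow> 'v ell2) set" where
  "bounded_operators E = {A \<in> E \<rightarrow>\<^sub>E E.
     (\<forall>f\<in>E. \<forall>g\<in>E. A (f + g) = A f + A g) \<and>
     (\<forall>c. \<forall>f\<in>E. A (c *\<^sub>C f) = c *\<^sub>C A f) \<and>
     (\<exists>K. \<forall>f\<in>E. norm (A f) \<le> K * norm f)}"

text \<open>The vertex set is the whole type \<open>'v\<close>, and \<open>(u, v) \<in> E\<close> means that \<open>u\<close> is the parent of \<open>v\<close>.\<close>

definition directed_tree :: "('v \<times> 'v) set \<Rightarrow> bool" where
  "directed_tree E \<longleftrightarrow> acyclic E \<and> (\<forall>u v. (u, v) \<in> (E \<union> E\<inverse>)\<^sup>*) \<and>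
     (\<forall>u u' v. (u, v) \<in> E \<longrightarrow> (u', v) \<in> E \<longrightarrow> u = u')"

definition rooted_directed_tree :: "('v \<times> 'v) set \<Rightarrow> bool" where
  "rooted_directed_tree E \<longleftrightarrow> directed_tree E \<and> (\<exists>!v. v \<notin> Range E)"

definition leafless :: "('v \<times> 'v) set \<Rightarrow> bool" where
  "leafless E \<longleftrightarrow> Domain E = UNIV"

definition tree_root :: "('v \<times> 'v) set \<Rightarrow> 'v" where
  "tree_root E = (THE v. v \<notin> Range E)"

definition par :: "('v \<times> 'v) set \<Rightarrow> 'v \<Rightarrow> 'v" where
  "par E v = (THE u. (u, v) \<in> E)"

text \<open>\<^term>\<open>par E (tree_root E)\<close> is an unspecified vertex, so further iterates may return to the root;
  the least exponent is the intended one.\<close>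

definition depth :: "('v \<times> 'v) set \<Rightarrow> 'v \<Rightarrow> nat" where
  "depth E v = (LEAST k. (par E ^^ k) v = tree_root E)"

text \<open>Only the values of the weight function \<open>lam\<close> at non-root vertices are used. An operator with
  domain in \<open>\<ell>\<^sup>2(V)\<close> is given by its pointwise formula, its maximal domain, and a function
  that is meaningful on that domain.\<close>

definition wshift_fun :: "('v \<times> 'v) set \<Rightarrow> ('v \<Rightarrow> real) \<Rightarrow> ('v \<Rightarrow> complex) \<Rightarrow> 'v \<Rightarrow> complex" where
  "wshift_fun E lam f v = (if v = tree_root E then 0 else complex_of_real (lam v) * f (par E v))"

definition wshift_dom :: "('v \<times> 'v) set \<Rightarrow> ('v \<Rightarrow> real) \<Rightarrow> 'v ell2 set" where
  "wshift_dom E lam = {f. square_summable (wshift_fun E lam (Rep_ell2 f))}"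

definition wshift :: "('v \<times> 'v) set \<Rightarrow> ('v \<Rightarrow> real) \<Rightarrow> 'v ell2 \<Rightarrow> 'v ell2" where
  "wshift E lam f = Abs_ell2 (wshift_fun E lam (Rep_ell2 f))"

definition path_weight :: "('v \<times> 'v) set \<Rightarrow> ('v \<Rightarrow> real) \<Rightarrow> nat \<Rightarrow> 'v \<Rightarrow> real" where
  "path_weight E lam k v = (\<Prod>n<k. lam ((par E ^^ n) v))"

definition mult_fun ::
  "('v \<times> 'v) set \<Rightarrow> ('v \<Rightarrow> real) \<Rightarrow> (nat \<Rightarrow> complex) \<Rightarrow> ('v \<Rightarrow> complex) \<Rightarrow> 'v \<Rightarrow> complex" where
  "mult_fun E lam \<phi> f v =
     (\<Sum>k\<le>depth E v. complex_of_real (path_weight E lam k v) * \<phi> k * f ((par E ^^ k) v))"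

definition mult_dom :: "('v \<times> 'v) set \<Rightarrow> ('v \<Rightarrow> real) \<Rightarrow> (nat \<Rightarrow> complex) \<Rightarrow> 'v ell2 set" where
  "mult_dom E lam \<phi> = {f. square_summable (mult_fun E lam \<phi> (Rep_ell2 f))}"

definition mult_op ::
  "('v \<times> 'v) set \<Rightarrow> ('v \<Rightarrow> real) \<Rightarrow> (nat \<Rightarrow> complex) \<Rightarrow> 'v ell2 \<Rightarrow> 'v ell2" where
  "mult_op E lam \<phi> f = Abs_ell2 (mult_fun E lam \<phi> (Rep_ell2 f))"

definition multiplier :: "('v \<times> 'v) set \<Rightarrow> ('v \<Rightarrow> real) \<Rightarrow> (nat \<Rightarrow> complex) \<Rightarrow> bool" where
  "multiplier E lam \<phi> \<longleftrightarrow> mult_dom E lam \<phi> = UNIV"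

definition canonical_left_inverse :: "('v ell2 \<Rightarrow> 'v ell2) \<Rightarrow> 'v ell2 \<Rightarrow> 'v ell2" where
  "canonical_left_inverse T = inv (cadjoint T \<circ> T) \<circ> cadjoint T"

definition model_radius :: "('v ell2 \<Rightarrow> 'v ell2) \<Rightarrow> real" where
  "model_radius T = 1 / spectral_radius (canonical_left_inverse T)"

definition model_coeff :: "('v ell2 \<Rightarrow> 'v ell2) \<Rightarrow> 'v ell2 \<Rightarrow> nat \<Rightarrow> 'v ell2" where
  "model_coeff T f n = orth_proj (ker (cadjoint T)) ((canonical_left_inverse T ^^ n) f)"

definition model_map :: "('v ell2 \<Rightarrow> 'v ell2) \<Rightarrow> 'v ell2 \<Rightarrow> complex \<Rightarrow> 'v ell2" where
  "model_map T f = (\<lambda>z\<in>ball 0 (model_radius T). \<Sum>n. z ^ n *\<^sub>C model_coeff T f n)"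

definition model_space :: "('v ell2 \<Rightarrow> 'v ell2) \<Rightarrow> (complex \<Rightarrow> 'v ell2) set" where
  "model_space T = range (model_map T)"

text \<open>The inner product on the model space is transported along the injective map
  \<^term>\<open>model_map T\<close>.\<close>

definition model_inner ::
  "('v ell2 \<Rightarrow> 'v ell2) \<Rightarrow> (complex \<Rightarrow> 'v ell2) \<Rightarrow> (complex \<Rightarrow> 'v ell2) \<Rightarrow> complex" where
  "model_inner T F G = cinner (inv (model_map T) F) (inv (model_map T) G)"

definition model_map_adj :: "('v ell2 \<Rightarrow> 'v ell2) \<Rightarrow> (complex \<Rightarrow> 'v ell2) \<Rightarrow> 'v ell2" where
  "model_map_adj T F = (THE f. \<forall>g. model_inner T (model_map T g) F = cinner g f)"

definition taylor_coeff :: "('v ell2 \<Rightarrow> 'v ell2) \<Rightarrow> (complex \<Rightarrow> 'v ell2) \<Rightarrow> nat \<Rightarrow> 'v ell2" where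
  "taylor_coeff T F n = model_coeff T (model_map_adj T F) n"

definition gmult_rel :: "('v ell2 \<Rightarrow> 'v ell2) \<Rightarrow> (nat \<Rightarrow> 'v ell2 \<Rightarrow> 'v ell2) \<Rightarrow>
    (complex \<Rightarrow> 'v ell2) \<Rightarrow> (complex \<Rightarrow> 'v ell2) \<Rightarrow> bool" where
  "gmult_rel T \<psi> F G \<longleftrightarrow> F \<in> model_space T \<and> G \<in> model_space T \<and>
     (\<forall>n. taylor_coeff T G n = (\<Sum>k\<le>n. \<psi> k (taylor_coeff T F (n - k))))"

definition gmult_dom ::
  "('v ell2 \<Rightarrow> 'v ell2) \<Rightarrow> (nat \<Rightarrow> 'v ell2 \<Rightarrow> 'v ell2) \<Rightarrow> (complex \<Rightarrow> 'v ell2) set" where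
  "gmult_dom T \<psi> = {F. \<exists>G. gmult_rel T \<psi> F G}"

definition gmult_op :: "('v ell2 \<Rightarrow> 'v ell2) \<Rightarrow> (nat \<Rightarrow> 'v ell2 \<Rightarrow> 'v ell2) \<Rightarrow>
    (complex \<Rightarrow> 'v ell2) \<Rightarrow> complex \<Rightarrow> 'v ell2" where
  "gmult_op T \<psi> F = (THE G. gmult_rel T \<psi> F G)"

definition generalized_multiplier ::
  "('v ell2 \<Rightarrow> 'v ell2) \<Rightarrow> (nat \<Rightarrow> 'v ell2 \<Rightarrow> 'v ell2) \<Rightarrow> bool" where
  "generalized_multiplier T \<psi> \<longleftrightarrow>
     (\<forall>n. \<psi> n \<in> bounded_operators (ker (cadjoint T))) \<and> gmult_dom T \<psi> = model_space T"

end

theory Submission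
  imports Defs "HOL-Complex_Analysis.Cauchy_Integral_Formula"
begin

text \<open>
  Put \<open>g\<^sub>N = (\<Sum>k\<le>N. a\<^sub>k T\<^sup>k f)\<close>. On vertices of depth at most \<open>N\<close> this function coincides with
  \<open>M\<^sub>\<phi> f\<close>, because \<open>T\<^sup>k f\<close> vanishes at depths below \<open>k\<close>; and for \<open>n \<le> N\<close> its coefficients
  \<open>P L\<^sup>n g\<^sub>N\<close> are the convolutions \<open>\<Sum>k\<le>n. a\<^sub>k P L\<^sup>n\<^sup>-\<^sup>k f\<close>, because \<open>L T = I\<close> and \<open>P T = 0\<close>.
  If \<open>g = M\<^sub>\<phi> f\<close>, then \<open>g - g\<^sub>N\<close> vanishes up to depth \<open>N\<close>, and since \<open>L\<close> only looks one
  generation down, \<open>P L\<^sup>n (g - g\<^sub>N)\<close> vanishes up to depth \<open>N - n\<close>; let \<open>N\<close> grow. Conversely, if the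
  coefficients of \<open>g\<close> are the convolutions, then \<open>g - g\<^sub>N = T\<^sup>N\<^sup>+\<^sup>1 L\<^sup>N\<^sup>+\<^sup>1 (g - g\<^sub>N)\<close>, which vanishes up to
  depth \<open>N\<close>.

  The model map determines the coefficients only if its disc is nondegenerate: \<open>(I - z T)\<^sup>-\<^sup>1 e\<close> with
  \<open>e \<in> ker T\<^sup>*\<close> is an eigenvector of \<open>L\<close> for every small \<open>z\<close>, so the spectral radius is positive and
  \<open>1 / r(L)\<close> is not the junk value \<open>1 / 0 = 0\<close>.
\<close>

section \<open>The Hilbert space of square-summable functions\<close>

lemma square_summable_Rep_ell2: "square_summable (Rep_ell2 f)"
  using Rep_ell2[of f] by simp

lemma Rep_ell2_scaleR: "Rep_ell2 (r *\<^sub>R f) v = complex_of_real r * Rep_ell2 f v"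
  by (simp add: scaleR_ell2_def scaleC.rep_eq)

lemma Rep_ell2_sum: "Rep_ell2 (sum f A) v = (\<Sum>i\<in>A. Rep_ell2 (f i) v)"
  by (induction A rule: infinite_finite_induct) (simp_all add: zero_ell2.rep_eq plus_ell2.rep_eq)

lemmas Rep_ell2_simps = zero_ell2.rep_eq plus_ell2.rep_eq minus_ell2.rep_eq uminus_ell2.rep_eq
  scaleC.rep_eq Rep_ell2_scaleR Rep_ell2_sum

lemma ell2_eqI: "(\<And>v. Rep_ell2 f v = Rep_ell2 g v) \<Longrightarrow> f = g"
  by (metis Rep_ell2_inject ext)

lemma bounded_linear_Rep_ell2: "bounded_linear (\<lambda>f. Rep_ell2 f v)"
proof (rule bounded_linear_intro[where K = 1])
  show "Rep_ell2 (r *\<^sub>R f) v = r *\<^sub>R Rep_ell2 f v" for r f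
    by (simp add: Rep_ell2_scaleR scaleR_conv_of_real)
qed (simp_all add: plus_ell2.rep_eq cmod_le_norm_ell2)

lemma scaleC_add_right: "c *\<^sub>C (f + g) = c *\<^sub>C f + c *\<^sub>C g"
  by (rule ell2_eqI) (simp add: Rep_ell2_simps distrib_left)

lemma scaleC_diff_right: "c *\<^sub>C (f - g) = c *\<^sub>C f - c *\<^sub>C g"
  by (rule ell2_eqI) (simp add: Rep_ell2_simps right_diff_distrib)

lemma scaleC_zero_right [simp]: "c *\<^sub>C 0 = 0"
  by (rule ell2_eqI) (simp add: Rep_ell2_simps)

lemma scaleC_scaleC [simp]: "c *\<^sub>C d *\<^sub>C f = (c * d) *\<^sub>C f"
  by (rule ell2_eqI) (simp add: Rep_ell2_simps)

lemma scaleC_one [simp]: "1 *\<^sub>C f = f"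
  by (rule ell2_eqI) (simp add: Rep_ell2_simps)

lemma scaleR_scaleC_commute: "r *\<^sub>R c *\<^sub>C f = c *\<^sub>C r *\<^sub>R f"
  by (rule ell2_eqI) (simp add: Rep_ell2_simps)

lemma norm_scaleC: "norm (c *\<^sub>C f) = cmod c * norm f"
proof (rule power2_eq_imp_eq)
  show "(norm (c *\<^sub>C f))\<^sup>2 = (cmod c * norm f)\<^sup>2"
    by (simp add: norm_ell2_sq scaleC.rep_eq norm_mult power_mult_distrib infsum_cmult_right')
qed simp_all

lemma cinner_commute: "cinner f g = cnj (cinner g f)"
  by (simp add: cinner.rep_eq mult.commute flip: infsum_cnj)

lemma cinner_add_left: "cinner (f + g) h = cinner f h + cinner g h"
  by transfer (simp add: distrib_right infsum_add square_summable_product)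

lemma cinner_scaleC_left: "cinner (c *\<^sub>C f) h = c * cinner f h"
  by transfer (simp add: mult.assoc infsum_cmult_right')

lemma cinner_diff_left: "cinner (f - g) h = cinner f h - cinner g h"
  using cinner_add_left[of "f - g" g h] by (simp add: algebra_simps)

lemma cinner_zero_left [simp]: "cinner 0 f = 0"
  using cinner_add_left[of 0 0 f] by simp

lemma cinner_add_right: "cinner h (f + g) = cinner h f + cinner h g"
  by (simp add: cinner_add_left cinner_commute[of h])

lemma cinner_diff_right: "cinner h (f - g) = cinner h f - cinner h g"
  by (simp add: cinner_diff_left cinner_commute[of h])

lemma cinner_scaleC_right: "cinner h (c *\<^sub>C f) = cnj c * cinner h f"
  by (simp add: cinner_scaleC_left cinner_commute[of h])

lemma cinner_zero_right [simp]: "cinner f 0 = 0"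
  by (simp add: cinner_commute[of f])

lemma cinner_sum_left: "cinner (sum f A) h = (\<Sum>i\<in>A. cinner (f i) h)"
  by (induction A rule: infinite_finite_induct) (simp_all add: cinner_add_left)

lemma cinner_sum_right: "cinner h (sum f A) = (\<Sum>i\<in>A. cinner h (f i))"
  by (induction A rule: infinite_finite_induct) (simp_all add: cinner_add_right)

lemma cinner_self_eq_0 [simp]: "cinner f f = 0 \<longleftrightarrow> f = 0"
  by (metis cinner_zero_left inner_ell2_def inner_eq_zero_iff zero_complex.simps(1))

lemma cinner_eqI:
  assumes "\<And>h. cinner h f = cinner h g"
  shows "f = g"
  using assms[of "f - g"] cinner_self_eq_0[of "f - g"] by (simp add: cinner_diff_right)

text \<open>The imaginary part of a number is the real part of its product with -\<i>. In this form,
  continuity of the real inner product carries over to \<open>cinner\<close>.\<close>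

lemma cinner_inner: "cinner f g = Complex (inner f g) (inner ((- \<i>) *\<^sub>C f) g)"
  by (simp add: complex_eq_iff inner_ell2_def cinner_scaleC_left)

lemma tendsto_cinner_left:
  fixes f :: "'a ell2"
  assumes "(X \<longlongrightarrow> f) F"
  shows "((\<lambda>i. cinner (X i) g) \<longlongrightarrow> cinner f g) F"
proof -
  have "bounded_linear (\<lambda>f :: 'a ell2. c *\<^sub>C f)" for c
    by (rule bounded_linear_intro[where K = "cmod c"])
      (simp_all add: scaleC_add_right scaleR_scaleC_commute norm_scaleC mult.commute)
  from bounded_linear.tendsto[OF this assms] show ?thesis
    unfolding cinner_inner by (intro tendsto_Complex tendsto_inner assms tendsto_const)
qed

section \<open>The standard orthonormal basis\<close>

definition ell2_delta :: "'v \<Rightarrow> 'v ell2" where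
  "ell2_delta u = Abs_ell2 (\<lambda>v. if v = u then 1 else 0)"

lemma Rep_ell2_delta: "Rep_ell2 (ell2_delta u) v = (if v = u then 1 else 0)"
proof -
  have "square_summable (\<lambda>v. if v = u then 1 else 0)"
    by (rule finite_nonzero_values_imp_summable_on) (rule finite_subset[of _ "{u}"], auto)
  then show ?thesis by (simp add: ell2_delta_def Abs_ell2_inverse)
qed

lemma cinner_delta_right [simp]: "cinner f (ell2_delta u) = Rep_ell2 f u"
proof -
  have "cinner f (ell2_delta u) = (\<Sum>\<^sub>\<infinity>v\<in>{u}. Rep_ell2 f v * cnj (Rep_ell2 (ell2_delta u) v))"
    unfolding cinner.rep_eq by (rule infsum_cong_neutral) (auto simp: Rep_ell2_delta)
  then show ?thesis by (simp add: Rep_ell2_delta)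
qed

lemma cinner_delta_left [simp]: "cinner (ell2_delta u) f = cnj (Rep_ell2 f u)"
  by (simp add: cinner_commute[of "ell2_delta u"])

lemma norm_delta_combination_sq:
  assumes "finite F"
  shows "(norm (\<Sum>u\<in>F. s u *\<^sub>C ell2_delta u))\<^sup>2 = (\<Sum>u\<in>F. (cmod (s u))\<^sup>2)"
proof -
  have "complex_of_real (\<Sum>u\<in>F. (cmod (s u))\<^sup>2) =
      cinner (\<Sum>u\<in>F. s u *\<^sub>C ell2_delta u) (\<Sum>u\<in>F. s u *\<^sub>C ell2_delta u)"
    using assms
    by (simp add: cinner_sum_right cinner_scaleC_right Rep_ell2_sum scaleC.rep_eq Rep_ell2_delta
        complex_norm_square if_distrib[of "\<lambda>x. _ * x"] mult.commute cong: if_cong del: of_real_power)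
  then show ?thesis
    by (metis Re_complex_of_real inner_ell2_def power2_norm_eq_inner)
qed

text \<open>By orthonormality the squared distance from a finite partial sum to \<open>f\<close> is
  the tail of the series for \<open>(norm f)\<^sup>2\<close>.\<close>

lemma has_sum_delta_expansion: "((\<lambda>v. Rep_ell2 f v *\<^sub>C ell2_delta v) has_sum f) UNIV"
proof -
  let ?s = "\<lambda>F. \<Sum>v\<in>F. Rep_ell2 f v *\<^sub>C ell2_delta v"
  have eq: "(dist (?s F) f)\<^sup>2 = (norm f)\<^sup>2 - (\<Sum>v\<in>F. (cmod (Rep_ell2 f v))\<^sup>2)" if "finite F" for F
  proof -
    have "inner f (?s F) = (\<Sum>v\<in>F. (cmod (Rep_ell2 f v))\<^sup>2)"
      by (simp add: inner_ell2_def cinner_sum_right cinner_scaleC_right mult.commute cmod_power2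
          flip: complex_norm_square power2_eq_square)
    moreover have "inner (?s F) (?s F) = (\<Sum>v\<in>F. (cmod (Rep_ell2 f v))\<^sup>2)"
      using norm_delta_combination_sq[OF that, of "Rep_ell2 f"] by (simp add: power2_norm_eq_inner)
    ultimately show ?thesis
      by (simp add: dist_norm power2_norm_eq_inner inner_diff inner_commute)
  qed
  have "((\<lambda>v. (cmod (Rep_ell2 f v))\<^sup>2) has_sum (norm f)\<^sup>2) UNIV"
    unfolding norm_ell2_sq by (rule has_sum_infsum[OF square_summable_Rep_ell2])
  then have "((\<lambda>F. (norm f)\<^sup>2 - (\<Sum>v\<in>F. (cmod (Rep_ell2 f v))\<^sup>2)) \<longlongrightarrow> (norm f)\<^sup>2 - (norm f)\<^sup>2)
      (finite_subsets_at_top UNIV)"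
    unfolding has_sum_def by (intro tendsto_intros)
  moreover have "\<forall>\<^sub>F F in finite_subsets_at_top UNIV.
      (norm f)\<^sup>2 - (\<Sum>v\<in>F. (cmod (Rep_ell2 f v))\<^sup>2) = (dist (?s F) f)\<^sup>2"
    by (rule eventually_finite_subsets_at_top_weakI) (simp add: eq)
  ultimately have "((\<lambda>F. (dist (?s F) f)\<^sup>2) \<longlongrightarrow> (norm f)\<^sup>2 - (norm f)\<^sup>2) (finite_subsets_at_top UNIV)"
    by (rule Lim_transform_eventually)
  then have "((\<lambda>F. sqrt ((dist (?s F) f)\<^sup>2)) \<longlongrightarrow> sqrt ((norm f)\<^sup>2 - (norm f)\<^sup>2)) (finite_subsets_at_top UNIV)"
    by (rule tendsto_real_sqrt)
  then show ?thesis
    unfolding has_sum_def by (subst tendsto_dist_iff) simp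
qed

section \<open>Bounded operators\<close>

lemma bounded_clinearI:
  assumes "\<And>f g. T (f + g) = T f + T g" "\<And>c f. T (c *\<^sub>C f) = c *\<^sub>C T f"
    and "\<And>f. norm (T f) \<le> K * norm f"
  shows "bounded_clinear T"
  unfolding bounded_clinear_def
proof
  show "bounded_linear T"
    by (rule bounded_linear_intro[where K = K])
      (use assms in \<open>simp_all add: scaleR_ell2_def mult.commute\<close>)
qed (use assms in simp)

lemma bounded_clinear_linear: "bounded_clinear T \<Longrightarrow> linear T"
  by (simp add: bounded_clinear_def bounded_linear.linear)

lemma bounded_clinear_scaleC: "bounded_clinear T \<Longrightarrow> T (c *\<^sub>C f) = c *\<^sub>C T f"
  by (simp add: bounded_clinear_def)

lemma bounded_clinear_bound:
  assumes "bounded_clinear T"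
  obtains K where "K > 0" "\<And>f. norm (T f) \<le> K * norm f"
  using assms unfolding bounded_clinear_def by (metis bounded_linear.pos_bounded mult.commute)

lemma bounded_clinear_ident: "bounded_clinear (\<lambda>f. f)"
  by (rule bounded_clinearI[where K = 1]) auto

lemma bounded_clinear_compose:
  assumes "bounded_clinear S" "bounded_clinear T"
  shows "bounded_clinear (\<lambda>f. S (T f))"
  using assms by (auto simp: bounded_clinear_def intro: bounded_linear_compose)

lemma bounded_clinear_diff:
  assumes "bounded_clinear S" "bounded_clinear T"
  shows "bounded_clinear (\<lambda>f. S f - T f)"
  using assms by (auto simp: bounded_clinear_def scaleC_diff_right intro: bounded_linear_sub)

lemma bounded_clinear_scale:
  assumes "bounded_clinear T"
  shows "bounded_clinear (\<lambda>f. c *\<^sub>C T f)"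
proof -
  have "bounded_clinear (\<lambda>f. c *\<^sub>C f)"
    by (rule bounded_clinearI[where K = "cmod c"])
      (simp_all add: scaleC_add_right norm_scaleC mult.commute)
  then show ?thesis using assms by (rule bounded_clinear_compose)
qed

lemma bounded_clinear_funpow: "bounded_clinear T \<Longrightarrow> bounded_clinear (T ^^ n)"
  by (induction n) (auto simp: id_def o_def bounded_clinear_ident intro: bounded_clinear_compose)

text \<open>\<open>R g\<close> is the fixed point of the contraction
  \<open>\<lambda>f. g + A f\<close>; the lower bound \<open>low\<close> gives its uniqueness and
  the bound of \<open>R\<close>.\<close>

lemma bounded_clinear_Neumann:
  assumes A: "bounded_clinear A" and q: "q < 1" "\<And>f. norm (A f) \<le> q * norm f"
  obtains R where "bounded_clinear R" "\<And>f. R (f - A f) = f" "\<And>f. R f - A (R f) = f"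
proof -
  note lin = bounded_clinear_linear[OF A]
  have low: "(1 - q) * norm f \<le> norm (f - A f)" for f
    using q(2)[of f] norm_triangle_ineq2[of f "A f"] by (simp add: algebra_simps)
  have inj: "f = g" if "f - A f = g - A g" for f g
  proof -
    have "(1 - q) * norm (f - g) \<le> 0"
      using low[of "f - g"] that by (simp add: linear_diff[OF lin] algebra_simps)
    then show ?thesis using q(1) by (simp add: mult_le_0_iff)
  qed
  have "\<exists>f. f - A f = g" for g
  proof -
    have "\<exists>!f. g + A f = f"
    \<comment> \<open>The fixed point theorem asks for a nonnegative constant, and \<open>q\<close>
      may be negative.\<close>
    proof (rule banach_fix_type[where c = "max 0 q"]; (intro allI)?)
      fix x y
      have "norm (A (x - y)) \<le> max 0 q * norm (x - y)"
        using q(2)[of "x - y"] by (meson max.cobounded2 mult_right_mono norm_ge_zero order_trans)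
      then show "dist (g + A x) (g + A y) \<le> max 0 q * dist x y"
        by (simp add: dist_norm linear_diff[OF lin])
    qed (use q in auto)
    then show ?thesis by (metis add_diff_cancel_right')
  qed
  then obtain R where R: "R g - A (R g) = g" for g
    by metis
  show ?thesis
  proof
    show RI: "R (f - A f) = f" for f
      by (rule inj) (rule R)
    show "R f - A (R f) = f" for f by (rule R)
    show "bounded_clinear R"
    proof (rule bounded_clinearI[where K = "1 / (1 - q)"])
      show "R (f + g) = R f + R g" for f g
        by (rule inj) (simp add: R linear_add[OF lin] add_diff_add)
      show "R (c *\<^sub>C f) = c *\<^sub>C R f" for c f
        by (rule inj) (use R[of f] R[of "c *\<^sub>C f"] in
          \<open>simp add: bounded_clinear_scaleC[OF A] flip: scaleC_diff_right\<close>)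
      show "norm (R f) \<le> 1 / (1 - q) * norm f" for f
        using low[of "R f"] R[of f] q(1) by (simp add: field_simps)
    qed
  qed
qed

text \<open>The adjoint is written down in coordinates: its value for \<open>g\<close> at
  \<open>u\<close> must be \<open>cinner g (T (ell2_delta u))\<close>. Once this is square-summable,
  the identity holds on finite combinations of basis vectors and extends by continuity.\<close>

lemma cadjoint_exists:
  assumes "bounded_clinear T"
  shows "\<exists>S. \<forall>f g. cinner (T f) g = cinner f (S g)"
proof -
  note lin = bounded_clinear_linear[OF assms]
  obtain K where K: "K > 0" "\<And>f. norm (T f) \<le> K * norm f"
    using bounded_clinear_bound[OF assms] by blast
  define s where "s g u = cinner g (T (ell2_delta u))" for g u
  have "square_summable (s g)" for g
  proof (rule nonneg_bdd_above_summable_on)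
    show "bdd_above (sum (\<lambda>u. (cmod (s g u))\<^sup>2) ` {F. F \<subseteq> UNIV \<and> finite F})"
    proof (rule bdd_aboveI2)
      fix F :: "'a set" assume "F \<in> {F. F \<subseteq> UNIV \<and> finite F}"
      then have fin: "finite F" by simp
      \<comment> \<open>\<open>h\<close> is the candidate cut down to \<open>F\<close>. Pairing
        \<open>g\<close> with \<open>T h\<close> returns \<open>(norm h)\<^sup>2\<close>, so one
        factor \<open>norm h\<close> cancels and the bound is uniform in \<open>F\<close>.\<close>
      define h where "h = (\<Sum>u\<in>F. s g u *\<^sub>C ell2_delta u)"
      have h: "(norm h)\<^sup>2 = (\<Sum>u\<in>F. (cmod (s g u))\<^sup>2)"
        unfolding h_def by (rule norm_delta_combination_sq[OF fin])
      also have "\<dots> = inner g (T h)"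
        by (simp add: h_def linear_sum[OF lin] bounded_clinear_scaleC[OF assms] inner_ell2_def
            cinner_sum_right cinner_scaleC_right mult.commute cmod_power2
            flip: complex_norm_square power2_eq_square s_def)
      also have "\<dots> \<le> norm g * (K * norm h)"
        by (rule order_trans[OF norm_cauchy_schwarz]) (simp add: K mult_left_mono)
      finally have "norm h * norm h \<le> (K * norm g) * norm h"
        by (simp add: power2_eq_square mult_ac)
      then have "norm h \<le> K * norm g"
        using K(1) by (cases "h = 0") (auto simp: mult_le_cancel_right)
      then have "(norm h)\<^sup>2 \<le> (K * norm g)\<^sup>2"
        by (simp add: power_mono)
      then show "(\<Sum>u\<in>F. (cmod (s g u))\<^sup>2) \<le> (K * norm g)\<^sup>2"
        by (simp add: h)
    qed
  qed simp
  then have Rep: "Rep_ell2 (Abs_ell2 (s g)) = s g" for g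
    by (simp add: Abs_ell2_inverse)
  have "cinner (T f) g = cinner f (Abs_ell2 (s g))" for f g
  proof (rule tendsto_unique[OF finite_subsets_at_top_neq_bot])
    let ?s = "\<lambda>F. \<Sum>v\<in>F. Rep_ell2 f v *\<^sub>C ell2_delta v"
    have lim: "(?s \<longlongrightarrow> f) (finite_subsets_at_top UNIV)"
      using has_sum_delta_expansion[of f] unfolding has_sum_def .
    have "((\<lambda>F. T (?s F)) \<longlongrightarrow> T f) (finite_subsets_at_top UNIV)"
      using assms lim by (auto simp: bounded_clinear_def intro: bounded_linear.tendsto)
    then show "((\<lambda>F. cinner (T (?s F)) g) \<longlongrightarrow> cinner (T f) g) (finite_subsets_at_top UNIV)"
      by (rule tendsto_cinner_left)
    have "cinner (T (?s F)) g = cinner (?s F) (Abs_ell2 (s g))" for F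
      by (simp add: linear_sum[OF lin] bounded_clinear_scaleC[OF assms] cinner_sum_left
          cinner_scaleC_left Rep s_def cinner_commute[of g])
    then show "((\<lambda>F. cinner (T (?s F)) g) \<longlongrightarrow> cinner f (Abs_ell2 (s g))) (finite_subsets_at_top UNIV)"
      using tendsto_cinner_left[OF lim] by simp
  qed
  then show ?thesis by (intro exI[of _ "\<lambda>g. Abs_ell2 (s g)"]) simp
qed

lemma cinner_cadjoint:
  assumes "bounded_clinear T"
  shows "cinner (T f) g = cinner f (cadjoint T g)"
proof -
  obtain S where S: "\<forall>f g. cinner (T f) g = cinner f (S g)"
    using cadjoint_exists[OF assms] by blast
  then have "cadjoint T = S"
    unfolding cadjoint_def
    by (intro the_equality S ext cinner_eqI) metis
  then show ?thesis using S by simp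
qed

lemma bounded_clinear_cadjoint:
  assumes "bounded_clinear T"
  shows "bounded_clinear (cadjoint T)"
proof -
  note adj = cinner_cadjoint[OF assms, symmetric]
  obtain K where K: "K > 0" "\<And>f. norm (T f) \<le> K * norm f"
    using bounded_clinear_bound[OF assms] by blast
  show ?thesis
  proof (rule bounded_clinearI[where K = K])
    show "cadjoint T (f + g) = cadjoint T f + cadjoint T g" for f g
      by (rule cinner_eqI) (simp add: adj cinner_add_right)
    show "cadjoint T (c *\<^sub>C f) = c *\<^sub>C cadjoint T f" for c f
      by (rule cinner_eqI) (simp add: adj cinner_scaleC_right)
    fix g
    have "norm (cadjoint T g) * norm (cadjoint T g) = inner (T (cadjoint T g)) g"
      by (simp add: inner_ell2_def adj flip: power2_eq_square power2_norm_eq_inner)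
        (simp add: power2_norm_eq_inner inner_ell2_def flip: adj)
    also have "\<dots> \<le> (K * norm (cadjoint T g)) * norm g"
      by (rule order_trans[OF norm_cauchy_schwarz]) (simp add: K mult_right_mono)
    finally show "norm (cadjoint T g) \<le> K * norm g"
      using K(1) by (cases "cadjoint T g = 0") (auto simp: mult_ac)
  qed
qed

section \<open>The analytic model of a left-invertible operator\<close>

locale left_invertible_operator =
  fixes T :: "'v ell2 \<Rightarrow> 'v ell2"
  assumes bounded_T: "bounded_clinear T" and left_invertible_T: "left_invertible T"
begin

abbreviation "L \<equiv> canonical_left_inverse T"

text \<open>A left inverse bounded by \<open>K\<close> gives
  \<open>norm f \<le> K * norm (T f)\<close>, so the Gram operator is bounded below as a quadratic
  form. A small multiple of it differs from the identity by a contraction.\<close>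

lemma gram_inverse_exists:
  "\<exists>R. bounded_clinear R \<and> (\<forall>f. R (cadjoint T (T f)) = f) \<and> (\<forall>f. cadjoint T (T (R f)) = f)"
proof -
  let ?D = "\<lambda>f. cadjoint T (T f)"
  have D: "bounded_clinear ?D"
    by (rule bounded_clinear_compose[OF bounded_clinear_cadjoint[OF bounded_T] bounded_T])
  obtain B where B: "bounded_clinear B" "B (T f) = f" for f
    using left_invertible_T unfolding left_invertible_def by (metis comp_apply id_apply)
  obtain K where K: "K > 0" "norm (B f) \<le> K * norm f" for f
    using bounded_clinear_bound[OF B(1)] by blast
  obtain M where M: "M > 0" "norm (?D f) \<le> M * norm f" for f
    using bounded_clinear_bound[OF D] by blast
  \<comment> \<open>In \<open>(norm (A f))\<^sup>2\<close> the cross term gains at least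
    \<open>2 * t / K\<^sup>2\<close> and the square term loses at most
    \<open>t\<^sup>2 * M\<^sup>2\<close>, both times \<open>(norm f)\<^sup>2\<close>. This
    \<open>t\<close> makes the loss half the gain.\<close>
  define t where "t = 1 / (K\<^sup>2 * M\<^sup>2)"
  have t: "t > 0" using K(1) M(1) by (simp add: t_def)
  define A where "A f = f - complex_of_real t *\<^sub>C ?D f" for f
  have A: "bounded_clinear A"
    unfolding A_def
    by (intro bounded_clinear_diff bounded_clinear_ident bounded_clinear_scale D)
  have "norm (A f) \<le> sqrt (1 - t / K\<^sup>2) * norm f" for f
  proof -
    have "norm f \<le> K * norm (T f)"
      using K(2)[of "T f"] by (simp add: B(2))
    then have "(norm f)\<^sup>2 \<le> (K * norm (T f))\<^sup>2"
      by (rule power_mono) simp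
    also have "(K * norm (T f))\<^sup>2 = K\<^sup>2 * inner f (?D f)"
      by (simp add: power_mult_distrib power2_norm_eq_inner inner_ell2_def
          cinner_cadjoint[OF bounded_T])
    finally have "(norm f)\<^sup>2 / K\<^sup>2 \<le> inner f (?D f)"
      using K(1) by (simp add: field_simps)
    then have "t * ((norm f)\<^sup>2 / K\<^sup>2) \<le> t * inner f (?D f)"
      using t by (intro mult_left_mono) auto
    moreover have "t\<^sup>2 * (norm (?D f))\<^sup>2 \<le> t\<^sup>2 * (M * norm f)\<^sup>2"
      by (intro mult_left_mono power_mono M) auto
    moreover have "t\<^sup>2 * (M * norm f)\<^sup>2 = t * ((norm f)\<^sup>2 / K\<^sup>2)"
      using K(1) M(1) by (simp add: t_def power_mult_distrib power2_eq_square)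
    moreover have "(norm (A f))\<^sup>2 = (norm f)\<^sup>2 - 2 * (t * inner f (?D f)) + t\<^sup>2 * (norm (?D f))\<^sup>2"
      unfolding A_def scaleR_ell2_def[symmetric]
      unfolding power2_norm_eq_inner
      by (simp add: inner_diff inner_commute power2_eq_square algebra_simps)
    ultimately have "(norm (A f))\<^sup>2 \<le> (1 - t / K\<^sup>2) * (norm f)\<^sup>2"
      by (simp add: algebra_simps)
    then have "sqrt ((norm (A f))\<^sup>2) \<le> sqrt ((1 - t / K\<^sup>2) * (norm f)\<^sup>2)"
      by (rule real_sqrt_le_mono)
    then show ?thesis by (simp add: real_sqrt_mult)
  qed
  moreover have "sqrt (1 - t / K\<^sup>2) < 1"
    using t K(1) by simp
  ultimately obtain R where R: "bounded_clinear R" "\<And>f. R (f - A f) = f" "\<And>f. R f - A (R f) = f"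
    using bounded_clinear_Neumann[OF A] by metis
  have "R (complex_of_real t *\<^sub>C ?D f) = f" "complex_of_real t *\<^sub>C ?D (R f) = f" for f
    using R(2,3)[of f] by (simp_all add: A_def)
  then show ?thesis
    by (intro exI[of _ "\<lambda>f. R (complex_of_real t *\<^sub>C f)"])
      (simp add: bounded_clinear_scaleC[OF R(1)] bounded_clinear_scaleC[OF D]
        bounded_clinear_compose[OF R(1)] bounded_clinear_scale bounded_clinear_ident)
qed

lemma bounded_clinear_L: "bounded_clinear L"
  and L_T [simp]: "L (T f) = f"
  and gram_L: "cadjoint T (T (L f)) = cadjoint T f"
proof -
  obtain R where R: "bounded_clinear R" "\<And>f. R (cadjoint T (T f)) = f" "\<And>f. cadjoint T (T (R f)) = f"
    using gram_inverse_exists by blast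
  have "inv (cadjoint T \<circ> T) = R"
    by (rule inv_unique_comp) (auto simp: R)
  then have L: "L = (\<lambda>f. R (cadjoint T f))"
    by (auto simp: canonical_left_inverse_def)
  show "bounded_clinear L"
    unfolding L by (rule bounded_clinear_compose[OF R(1) bounded_clinear_cadjoint[OF bounded_T]])
  show "L (T f) = f" "cadjoint T (T (L f)) = cadjoint T f"
    by (simp_all add: L R)
qed

lemmas linear_T = bounded_clinear_linear[OF bounded_T]
  and linear_L = bounded_clinear_linear[OF bounded_clinear_L]
  and linear_cadjoint = bounded_clinear_linear[OF bounded_clinear_cadjoint[OF bounded_T]]

lemma L_eq_0: "cadjoint T e = 0 \<Longrightarrow> L e = 0"
  by (simp add: canonical_left_inverse_def)
    (metis L_T canonical_left_inverse_def comp_apply linear_0[OF linear_T] linear_0[OF linear_cadjoint])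

text \<open>The kernel of the adjoint is orthogonal to the range of \<open>T\<close>, so
  \<open>f - T (L f)\<close> and \<open>T (L f)\<close> split \<open>f\<close> orthogonally. Two
  candidates for the projection differ by a vector of the kernel that is orthogonal to
  itself.\<close>

lemma orth_proj_ker: "orth_proj (ker (cadjoint T)) f = f - T (L f)"
  unfolding orth_proj_def
proof (rule the_equality)
  let ?E = "ker (cadjoint T)"
  have p: "f - T (L f) \<in> ?E"
    by (simp add: ker_def linear_diff[OF linear_cadjoint] gram_L)
  have o: "cinner (f - (f - T (L f))) e = 0" if "e \<in> ?E" for e
    using that by (simp add: ker_def cinner_cadjoint[OF bounded_T])
  show "f - T (L f) \<in> ?E \<and> (\<forall>e\<in>?E. cinner (f - (f - T (L f))) e = 0)"
    using p o by blast
  fix q assume q: "q \<in> ?E \<and> (\<forall>e\<in>?E. cinner (f - q) e = 0)"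
  let ?d = "q - (f - T (L f))"
  have "?d \<in> ?E"
    using p q by (simp add: ker_def linear_diff[OF linear_cadjoint])
  then have "cinner (f - q) ?d = 0" "cinner (f - (f - T (L f))) ?d = 0"
    using q o by blast+
  then have "cinner ?d ?d = 0"
    by (simp add: cinner_diff_left)
  then show "q = f - T (L f)" by simp
qed

lemma model_coeff_eq: "model_coeff T f n = (L ^^ n) f - T ((L ^^ Suc n) f)"
  by (simp add: model_coeff_def orth_proj_ker)

lemma model_coeff_in_ker: "model_coeff T f n \<in> ker (cadjoint T)"
  by (simp add: model_coeff_eq ker_def linear_diff[OF linear_cadjoint] gram_L)

lemma bounded_clinear_model_coeff: "bounded_clinear (\<lambda>f. model_coeff T f n)"
  unfolding model_coeff_eq
  by (intro bounded_clinear_diff bounded_clinear_compose[OF bounded_T] bounded_clinear_funpow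
      bounded_clinear_L)

lemmas linear_model_coeff = bounded_clinear_linear[OF bounded_clinear_model_coeff]

lemma L_funpow_T_funpow: "(L ^^ k) ((T ^^ k) f) = f"
  by (induction k arbitrary: f) (simp_all add: funpow_swap1)

text \<open>Cancelling \<open>L T = I\<close> leaves a power of \<open>L\<close>, or, for
  \<open>k > n\<close>, at least one factor \<open>T\<close>, whose range the projection
  annihilates. On coefficients \<open>T\<close> is thus the shift.\<close>

lemma model_coeff_T_funpow:
  "model_coeff T ((T ^^ k) f) n = (if k \<le> n then model_coeff T f (n - k) else 0)"
proof (cases "k \<le> n")
  case True
  then obtain m where "n = m + k" by (metis le_add_diff_inverse2)
  moreover have "(L ^^ (m + k)) ((T ^^ k) f) = (L ^^ m) f" for m
    by (simp add: funpow_add L_funpow_T_funpow)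
  ultimately show ?thesis
    by (simp add: model_coeff_eq del: funpow.simps flip: add_Suc)
next
  case False
  then obtain m where "k = n + Suc m" by (metis not_le less_imp_Suc_add add_Suc_right)
  then have "(T ^^ k) f = (T ^^ n) ((T ^^ Suc m) f)"
    by (simp only: funpow_add comp_apply)
  then have "(L ^^ n) ((T ^^ k) f) = T ((T ^^ m) f)"
    by (simp add: L_funpow_T_funpow)
  then show ?thesis using False by (simp add: model_coeff_eq)
qed

text \<open>A vanishing coefficient of index \<open>n\<close> says
  \<open>(L ^^ n) f = T ((L ^^ Suc n) f)\<close>, and these equations chain.\<close>

lemma funpow_decomposition:
  assumes "\<And>n. n < N \<Longrightarrow> model_coeff T f n = 0"
  shows "f = (T ^^ N) ((L ^^ N) f)"
  using assms
proof (induction N)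
  case (Suc N)
  then have "(L ^^ N) f = T ((L ^^ Suc N) f)"
    using Suc.prems[of N] by (simp add: model_coeff_eq)
  moreover have "f = (T ^^ N) ((L ^^ N) f)"
    using Suc by simp
  ultimately show ?case by (metis funpow_Suc_right comp_apply)
qed simp

lemma spectral_radius_L_pos:
  assumes e: "e \<in> ker (cadjoint T)" "e \<noteq> 0"
  shows "spectral_radius L > 0"
proof -
  obtain K where K: "K > 0" "norm (T f) \<le> K * norm f" for f
    using bounded_clinear_bound[OF bounded_T] by blast
  \<comment> \<open>This size makes \<open>z T\<close> a contraction with constant 1/2 while
    \<open>z\<close> stays nonzero.\<close>
  define z where "z = complex_of_real (1 / (2 * K))"
  have z: "cmod z = 1 / (2 * K)" "cmod z > 0"
    using K(1) by (simp_all add: z_def norm_divide)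
  have "norm (z *\<^sub>C T f) \<le> 1 / 2 * norm f" for f
    using K(1) K(2)[of f] by (simp add: norm_scaleC z field_simps)
  then obtain R where R: "\<And>f. R f - z *\<^sub>C T (R f) = f"
    using bounded_clinear_Neumann[OF bounded_clinear_scale[OF bounded_T, of z], of "1/2"]
    by (metis one_less_numeral_iff half_gt_zero_iff less_divide_eq_1
        divide_less_eq_1_pos semiring_norm(76) zero_less_numeral)
  have "L (R e - z *\<^sub>C T (R e)) = 0"
    using e(1) by (simp add: R L_eq_0 ker_def)
  then have eigen: "L (R e) - z *\<^sub>C R e = 0"
    by (simp add: linear_diff[OF linear_L] bounded_clinear_scaleC[OF bounded_clinear_L])
  have "R e \<noteq> 0"
    using R[of e] e(2) by (auto simp: linear_0[OF linear_T])
  have "z \<in> spectrum L"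
    unfolding spectrum_def
  proof safe
    fix Q assume Q: "bounded_clinear Q" "Q \<circ> (\<lambda>f. L f - z *\<^sub>C f) = id"
    have "R e = Q (L (R e) - z *\<^sub>C R e)"
      using Q(2) by (metis comp_apply id_apply)
    also have "\<dots> = 0"
      unfolding eigen by (rule linear_0[OF bounded_clinear_linear[OF Q(1)]])
    finally show False using \<open>R e \<noteq> 0\<close> by simp
  qed
  obtain C where C: "C > 0" "norm (L f) \<le> C * norm f" for f
    using bounded_clinear_bound[OF bounded_clinear_L] by blast
  \<comment> \<open>The supremum defining \<open>spectral_radius\<close> is known to dominate its
    members only for a set bounded above. For \<open>cmod w > C\<close> the Neumann lemma inverts
    \<open>L - w I = - w (I - L / w)\<close>.\<close>
  have "cmod w \<le> C" if "w \<in> spectrum L" for w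
  proof (rule ccontr)
    assume w: "\<not> cmod w \<le> C"
    then have "w \<noteq> 0" using C(1) by auto
    have A: "bounded_clinear (\<lambda>f. inverse w *\<^sub>C L f)"
      by (rule bounded_clinear_scale[OF bounded_clinear_L])
    have "norm (inverse w *\<^sub>C L f) \<le> C / cmod w * norm f" for f
      using C(2)[of f] \<open>w \<noteq> 0\<close> by (simp add: norm_scaleC norm_divide field_simps)
    moreover have "C / cmod w < 1"
      using w C(1) \<open>w \<noteq> 0\<close> by (simp add: divide_less_eq_1)
    ultimately obtain Q where Q: "bounded_clinear Q" "\<And>f. Q (f - inverse w *\<^sub>C L f) = f"
        "\<And>f. Q f - inverse w *\<^sub>C L (Q f) = f"
      using bounded_clinear_Neumann[OF A] by metis
    have eq: "L f - w *\<^sub>C f = (- w) *\<^sub>C (f - inverse w *\<^sub>C L f)" for f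
      using \<open>w \<noteq> 0\<close> by (intro ell2_eqI) (simp add: Rep_ell2_simps field_simps)
    have "bounded_clinear (\<lambda>f. inverse (- w) *\<^sub>C Q f)"
      by (rule bounded_clinear_scale[OF Q(1)])
    moreover have "(\<lambda>f. inverse (- w) *\<^sub>C Q f) \<circ> (\<lambda>f. L f - w *\<^sub>C f) = id"
      using \<open>w \<noteq> 0\<close>
      by (intro ext) (simp add: eq bounded_clinear_scaleC[OF Q(1)] Q(2))
    moreover have "(\<lambda>f. L f - w *\<^sub>C f) \<circ> (\<lambda>f. inverse (- w) *\<^sub>C Q f) = id"
    proof
      fix f
      have "inverse (- w) *\<^sub>C Q f - inverse w *\<^sub>C L (inverse (- w) *\<^sub>C Q f)
          = inverse (- w) *\<^sub>C (Q f - inverse w *\<^sub>C L (Q f))"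
        by (simp add: bounded_clinear_scaleC[OF bounded_clinear_L] scaleC_diff_right mult.commute)
      then show "((\<lambda>f. L f - w *\<^sub>C f) \<circ> (\<lambda>f. inverse (- w) *\<^sub>C Q f)) f = id f"
        using \<open>w \<noteq> 0\<close> by (simp add: eq Q(3))
    qed
    ultimately show False using that unfolding spectrum_def by blast
  qed
  then have "bdd_above (cmod ` spectrum L)"
    by (intro bdd_aboveI2)
  then have "cmod z \<le> spectral_radius L"
    unfolding spectral_radius_def by (rule cSUP_upper[OF \<open>z \<in> spectrum L\<close>])
  then show ?thesis using z(2) by linarith
qed

text \<open>In each coordinate the model map is a scalar power series, so the identity theorem
  applies once the disc has positive radius, which \<open>e\<close> ensures.\<close>

lemma model_map_eq_imp_coeff_eq:
  assumes e: "e \<in> ker (cadjoint T)" "e \<noteq> 0"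
    and eq: "model_map T f = model_map T g"
  shows "model_coeff T f = model_coeff T g"
proof -
  obtain K where K: "K > 0" "norm (L f) \<le> K * norm f" for f
    using bounded_clinear_bound[OF bounded_clinear_L] by blast
  obtain C where C: "C > 0" "norm (model_coeff T f 0) \<le> C * norm f" for f
    using bounded_clinear_bound[OF bounded_clinear_model_coeff] by blast
  have pow: "norm ((L ^^ n) f) \<le> K ^ n * norm f" for n f
  proof (induction n)
    case (Suc n)
    have "norm (L ((L ^^ n) f)) \<le> K * (K ^ n * norm f)"
      using K(1) Suc K(2) by (meson order_trans mult_left_mono less_imp_le)
    then show ?case by (simp add: mult_ac)
  qed simp
  have coeff: "norm (model_coeff T f n) \<le> C * (K ^ n * norm f)" for n f
  proof -
    have "model_coeff T f n = model_coeff T ((L ^^ n) f) 0"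
      by (simp add: model_coeff_eq)
    then show ?thesis
      using C pow by (metis order_trans mult_left_mono less_imp_le)
  qed
  \<comment> \<open>Below \<open>1 / K\<close> the bound \<open>coeff\<close> gives convergence by a
    geometric series; the minimum keeps \<open>z\<close> where \<open>model_map\<close> is not
    \<open>undefined\<close>.\<close>
  define \<rho> where "\<rho> = min (model_radius T) (1 / K)"
  have "\<rho> > 0"
    using spectral_radius_L_pos[OF e] K(1) by (simp add: \<rho>_def model_radius_def)
  have sums: "(\<lambda>n. Rep_ell2 (model_coeff T f n) v * z ^ n) sums Rep_ell2 (model_map T f z) v"
    if z: "cmod z < \<rho>" for f v z
  proof -
    have "summable (\<lambda>n. z ^ n *\<^sub>C model_coeff T f n)"
    proof (rule summable_comparison_test')
      show "summable (\<lambda>n. (C * norm f) * (K * cmod z) ^ n)"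
        using z K(1) by (intro summable_mult summable_geometric) (simp add: \<rho>_def field_simps)
      show "norm (z ^ n *\<^sub>C model_coeff T f n) \<le> (C * norm f) * (K * cmod z) ^ n" for n
        using mult_left_mono[OF coeff[of f n], of "cmod z ^ n"]
        by (simp add: norm_scaleC norm_power power_mult_distrib mult_ac)
    qed
    then have "(\<lambda>n. z ^ n *\<^sub>C model_coeff T f n) sums model_map T f z"
      using z by (simp add: model_map_def \<rho>_def summable_sums)
    from bounded_linear.sums[OF bounded_linear_Rep_ell2 this, of v] show ?thesis
      by (simp add: scaleC.rep_eq mult.commute)
  qed
  have "Rep_ell2 (model_coeff T f n) v = Rep_ell2 (model_coeff T g n) v" for n v
  proof -
    define c where "c n = Rep_ell2 (model_coeff T f n) v - Rep_ell2 (model_coeff T g n) v" for n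
    have c: "(\<lambda>n. c n * z ^ n) sums 0" if "cmod z < \<rho>" for z
      using sums_diff[OF sums[OF that, of f v] sums[OF that, of g v]]
      by (simp add: c_def eq left_diff_distrib)
    have "c n = 0"
    proof (rule ccontr)
      assume "c n \<noteq> 0"
      moreover have "c 0 = 0"
        using c[of 0] \<open>\<rho> > 0\<close> by simp
      ultimately have "n > 0" by (cases n) auto
      \<comment> \<open>A power series that is 0 at the centre and has a nonzero coefficient of
        positive index has no zero in some punctured disc; this one sums to 0 throughout.\<close>
      show False
      proof (rule powser_0_nonzero[of \<rho> 0 c "\<lambda>_. 0" n])
        fix s :: real
        assume "s > 0" "\<And>z :: complex. z \<in> cball 0 s - {0} \<Longrightarrow> (0::complex) \<noteq> 0"
        from this(2)[of "complex_of_real s"] this(1) show False by simp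
      qed (use \<open>\<rho> > 0\<close> c \<open>c n \<noteq> 0\<close> \<open>n > 0\<close> in auto)
    qed
    then show ?thesis by (simp add: c_def)
  qed
  then show ?thesis by (intro ext ell2_eqI)
qed

end

section \<open>Weighted shifts\<close>

context
  fixes E :: "('v \<times> 'v) set"
  assumes tree: "rooted_directed_tree E"
begin

lemma par_edge: "(u, v) \<in> E \<Longrightarrow> par E v = u"
  using tree unfolding rooted_directed_tree_def directed_tree_def par_def
  by (intro the_equality) blast+

lemma tree_root_iff: "v = tree_root E \<longleftrightarrow> v \<notin> Range E"
proof -
  have unique: "\<exists>!v. v \<notin> Range E"
    using tree unfolding rooted_directed_tree_def by simp
  show ?thesis
    unfolding tree_root_def using theI'[OF unique] the1_equality[OF unique, of v] by blast
qed

text \<open>Connectedness gives an undirected walk from the root to \<open>v\<close>. A step to a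
  child adds one iterate of \<open>par\<close>, a step to the parent removes one.\<close>

lemma par_funpow_root_exists: "\<exists>k. (par E ^^ k) v = tree_root E"
proof -
  have "(tree_root E, v) \<in> (E \<union> E\<inverse>)\<^sup>*"
    using tree unfolding rooted_directed_tree_def directed_tree_def by blast
  then show ?thesis
  proof (induction rule: rtrancl_induct)
    case base
    show ?case by (rule exI[of _ 0]) simp
  next
    case (step u v)
    then obtain k where k: "(par E ^^ k) u = tree_root E" by blast
    show ?case
    proof (cases "(u, v) \<in> E")
      case True
      then have "(par E ^^ Suc k) v = tree_root E"
        using k by (simp add: par_edge funpow_swap1)
      then show ?thesis by blast
    next
      case False
      then have "(v, u) \<in> E" using step by blast
      then have "u \<noteq> tree_root E" "par E u = v"
        by (auto simp: tree_root_iff par_edge)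
      \<comment> \<open>The exponent 0 would make \<open>u\<close> the root, which has no
        parent.\<close>
      with k obtain j where "k = Suc j" by (cases k) auto
      then have "(par E ^^ j) v = tree_root E"
        using k \<open>par E u = v\<close> by (simp add: funpow_swap1)
      then show ?thesis by blast
    qed
  qed
qed

lemma depth_root [simp]: "depth E (tree_root E) = 0"
  unfolding depth_def by (rule Least_equality) auto

lemma depth_par:
  assumes "v \<noteq> tree_root E"
  shows "depth E v = Suc (depth E (par E v))"
proof -
  obtain k where "(par E ^^ k) v = tree_root E"
    using par_funpow_root_exists by blast
  then have "depth E v = Suc (LEAST k. (par E ^^ Suc k) v = tree_root E)"
    unfolding depth_def by (rule Least_Suc) (use assms in simp)
  then show ?thesis by (simp add: depth_def funpow_swap1)
qed

end

section \<open>Powers, coefficients and locality of a left-invertible weighted shift\<close>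

locale left_invertible_wshift =
  fixes E :: "('v \<times> 'v) set" and lam :: "'v \<Rightarrow> real"
  assumes tree: "rooted_directed_tree E"
    and wshift_dom: "wshift_dom E lam = UNIV"
    and bounded_wshift: "bounded_clinear (wshift E lam)"
    and left_invertible_wshift: "left_invertible (wshift E lam)"
begin

abbreviation "T \<equiv> wshift E lam"

sublocale left_invertible_operator T
  by unfold_locales (rule bounded_wshift left_invertible_wshift)+

lemma Rep_wshift:
  "Rep_ell2 (T f) v = (if v = tree_root E then 0 else complex_of_real (lam v) * Rep_ell2 f (par E v))"
proof -
  have "square_summable (wshift_fun E lam (Rep_ell2 f))"
    using wshift_dom by (auto simp: wshift_dom_def)
  then show ?thesis
    by (simp add: wshift_def Abs_ell2_inverse wshift_fun_def)
qed

text \<open>The shift is 0 at the root, so a path climbing past it contributes nothing; this keeps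
  the arbitrary value of \<open>par\<close> at the root out of the formula.\<close>

lemma Rep_wshift_funpow:
  "Rep_ell2 ((T ^^ k) f) v =
    (if k \<le> depth E v then complex_of_real (path_weight E lam k v) * Rep_ell2 f ((par E ^^ k) v) else 0)"
proof (induction k arbitrary: v)
  case (Suc k)
  show ?case
  proof (cases "v = tree_root E")
    case False
    have "path_weight E lam (Suc k) v = lam v * path_weight E lam k (par E v)"
      by (simp add: path_weight_def prod.lessThan_Suc_shift funpow_swap1 del: prod.lessThan_Suc)
    moreover have "par E ((par E ^^ k) v) = (par E ^^ k) (par E v)"
      by (rule funpow_swap1)
    ultimately show ?thesis
      using False by (simp add: Rep_wshift Suc depth_par[OF tree])
  qed (simp add: Rep_wshift depth_root[OF tree])
qed (simp add: path_weight_def)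

lemma mult_fun_eq: "mult_fun E lam \<phi> (Rep_ell2 f) v = (\<Sum>k\<le>depth E v. \<phi> k * Rep_ell2 ((T ^^ k) f) v)"
  unfolding mult_fun_def by (rule sum.cong) (simp_all add: Rep_wshift_funpow)

text \<open>Every function in the range of \<open>T\<close> vanishes at the root. This supplies the
  nonzero kernel vector that the model disc requires.\<close>

lemma delta_root_in_ker: "ell2_delta (tree_root E) \<in> ker (cadjoint T)"
proof -
  have "cinner f (cadjoint T (ell2_delta (tree_root E))) = 0" for f
    by (simp add: Rep_wshift flip: cinner_cadjoint[OF bounded_wshift])
  then show ?thesis
    unfolding ker_def by (metis cinner_eqI cinner_zero_right mem_Collect_eq)
qed

lemma delta_neq_0: "ell2_delta u \<noteq> 0"
  using Rep_ell2_delta[of u u] by (metis zero_ell2.rep_eq zero_neq_one)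

text \<open>If \<open>d\<close> is the depth of \<open>v\<close>, then \<open>f\<close> lies in the
  range of \<open>T ^^ Suc d\<close>, whose members vanish at depth \<open>d\<close>. This is a
  local form of analyticity.\<close>

lemma eq_0_if_model_coeff_eq_0:
  assumes "\<And>n. n \<le> depth E v \<Longrightarrow> model_coeff T f n = 0"
  shows "Rep_ell2 f v = 0"
proof -
  have "f = (T ^^ Suc (depth E v)) ((L ^^ Suc (depth E v)) f)"
    by (rule funpow_decomposition) (simp add: assms)
  then have "Rep_ell2 f v = Rep_ell2 ((T ^^ Suc (depth E v)) ((L ^^ Suc (depth E v)) f)) v"
    by simp
  also have "\<dots> = 0"
    by (simp only: Rep_wshift_funpow) simp
  finally show ?thesis .
qed

lemma inj_model_coeff: "model_coeff T f = model_coeff T g \<Longrightarrow> f = g"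
proof (rule ell2_eqI)
  fix v assume "model_coeff T f = model_coeff T g"
  then have "Rep_ell2 (f - g) v = 0"
    by (intro eq_0_if_model_coeff_eq_0) (simp add: linear_diff[OF linear_model_coeff])
  then show "Rep_ell2 f v = Rep_ell2 g v"
    by (simp add: minus_ell2.rep_eq)
qed

lemma inj_model_map: "inj (model_map T)"
  by (rule injI) (rule inj_model_coeff[OF model_map_eq_imp_coeff_eq[OF delta_root_in_ker delta_neq_0]])

text \<open>The model inner product is transported along the injective \<open>model_map T\<close>,
  so the adjoint undoes this map.\<close>

lemma model_map_adj_model_map [simp]: "model_map_adj T (model_map T f) = f"
  unfolding model_map_adj_def model_inner_def
proof (rule the_equality)
  fix h
  assume "\<forall>g. cinner (inv (model_map T) (model_map T g)) (inv (model_map T) (model_map T f)) = cinner g h"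
  then have "cinner g h = cinner g f" for g
    by (simp add: inv_f_f[OF inj_model_map])
  then show "h = f" by (rule cinner_eqI)
qed (simp add: inv_f_f[OF inj_model_map])

lemma taylor_coeff_model_map [simp]: "taylor_coeff T (model_map T f) = model_coeff T f"
  by (simp add: taylor_coeff_def fun_eq_iff)

text \<open>Thus \<open>T\<^sup>* T\<close> is diagonal, and \<open>L f\<close> at \<open>u\<close> depends only on the values of \<open>f\<close> at the
  children of \<open>u\<close>.\<close>

lemma cinner_wshift_delta:
  "cinner (T f) (T (ell2_delta u)) = Rep_ell2 f u * complex_of_real ((norm (T (ell2_delta u)))\<^sup>2)"
proof -
  \<comment> \<open>At a child of \<open>u\<close> the shift reads \<open>f\<close> at
    \<open>u\<close>; at all other vertices \<open>T (ell2_delta u)\<close> is 0.\<close>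
  have "cinner (T f) (T (ell2_delta u)) = cinner (Rep_ell2 f u *\<^sub>C T (ell2_delta u)) (T (ell2_delta u))"
    unfolding cinner.rep_eq by (rule infsum_cong) (simp add: Rep_wshift scaleC.rep_eq Rep_ell2_delta)
  moreover have "cinner g g = complex_of_real ((norm g)\<^sup>2)" for g :: "'v ell2"
    using cinner_commute[of g g] by (simp add: complex_eq_iff power2_norm_eq_inner inner_ell2_def)
  ultimately show ?thesis by (simp add: cinner_scaleC_left)
qed

lemma L_eq_0_local:
  assumes "\<And>v. depth E v \<le> Suc N \<Longrightarrow> Rep_ell2 f v = 0" and "depth E u \<le> N"
  shows "Rep_ell2 (L f) u = 0"
proof -
  \<comment> \<open>By \<open>gram_L\<close>, \<open>T (L f)\<close> and \<open>f\<close> pair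
    equally with the range of \<open>T\<close>, and \<open>T (ell2_delta u)\<close> lives on the
    children of \<open>u\<close>, where \<open>f\<close> is 0.\<close>
  have "cinner (T (L f)) (T (ell2_delta u)) = cnj (cinner (T (ell2_delta u)) (T (L f)))"
    by (rule cinner_commute)
  also have "\<dots> = cnj (cinner (T (ell2_delta u)) f)"
    by (simp add: cinner_cadjoint[OF bounded_wshift] gram_L del: cinner_delta_left)
  also have "\<dots> = cinner f (T (ell2_delta u))"
    by (rule cinner_commute[symmetric])
  also have "\<dots> = 0"
    unfolding cinner.rep_eq
  proof (rule infsum_0)
    fix v
    show "Rep_ell2 f v * cnj (Rep_ell2 (T (ell2_delta u)) v) = 0"
      using assms depth_par[OF tree, of v] by (cases "par E v = u") (auto simp: Rep_wshift Rep_ell2_delta)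
  qed
  finally have "Rep_ell2 (L f) u * complex_of_real ((norm (T (ell2_delta u)))\<^sup>2) = 0"
    by (simp only: cinner_wshift_delta)
  moreover have "T (ell2_delta u) \<noteq> 0"
    by (metis L_T delta_neq_0 linear_0[OF linear_L])
  ultimately show ?thesis by simp
qed

lemma L_funpow_eq_0_local:
  assumes "\<And>v. depth E v \<le> N + n \<Longrightarrow> Rep_ell2 f v = 0" and "depth E u \<le> N"
  shows "Rep_ell2 ((L ^^ n) f) u = 0"
  using assms
proof (induction n arbitrary: N u)
  case (Suc n)
  show ?case
    by (simp, rule L_eq_0_local[of N], rule Suc.IH[of "Suc N"]) (use Suc.prems in auto)
qed simp

lemma model_coeff_eq_0_local:
  assumes "\<And>v. depth E v \<le> depth E u + n \<Longrightarrow> Rep_ell2 f v = 0"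
  shows "Rep_ell2 (model_coeff T f n) u = 0"
proof -
  have "Rep_ell2 ((L ^^ n) f) u = 0"
    by (rule L_funpow_eq_0_local[of "depth E u"]) (use assms in auto)
  \<comment> \<open>The extra \<open>L\<close> costs one generation, but \<open>T\<close> evaluates
    its result at the parent, one generation nearer the root.\<close>
  moreover have "Rep_ell2 ((L ^^ Suc n) f) (par E u) = 0" if "u \<noteq> tree_root E"
    by (rule L_funpow_eq_0_local[of "depth E (par E u)"])
      (use assms depth_par[OF tree that] in auto)
  ultimately show ?thesis
    by (simp add: model_coeff_eq Rep_ell2_simps Rep_wshift del: funpow.simps)
qed

section \<open>Multipliers as convolutions of coefficients\<close>

lemma model_coeff_partial_sum:
  assumes "n \<le> N"
  shows "model_coeff T (\<Sum>k\<le>N. a k *\<^sub>C (T ^^ k) f) n = (\<Sum>k\<le>n. a k *\<^sub>C model_coeff T f (n - k))"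
proof -
  have "model_coeff T (\<Sum>k\<le>N. a k *\<^sub>C (T ^^ k) f) n =
      (\<Sum>k\<le>N. if k \<le> n then a k *\<^sub>C model_coeff T f (n - k) else 0)"
    by (simp add: linear_sum[OF linear_model_coeff] bounded_clinear_scaleC[OF bounded_clinear_model_coeff]
        model_coeff_T_funpow if_distrib[of "\<lambda>x. _ *\<^sub>C x"] cong: if_cong)
  also have "\<dots> = (\<Sum>k\<le>n. a k *\<^sub>C model_coeff T f (n - k))"
    using assms by (intro sum.mono_neutral_cong_right) auto
  finally show ?thesis .
qed

lemma Rep_partial_sum:
  assumes "depth E v \<le> N"
  shows "Rep_ell2 (\<Sum>k\<le>N. a k *\<^sub>C (T ^^ k) f) v = mult_fun E lam a (Rep_ell2 f) v"
  unfolding mult_fun_eq Rep_ell2_sum scaleC.rep_eq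
  using assms by (intro sum.mono_neutral_right) (auto simp: Rep_wshift_funpow)

lemma mult_fun_iff_model_coeff:
  "Rep_ell2 g = mult_fun E lam a (Rep_ell2 f) \<longleftrightarrow>
    (\<forall>n. model_coeff T g n = (\<Sum>k\<le>n. a k *\<^sub>C model_coeff T f (n - k)))" (is "?lhs \<longleftrightarrow> ?rhs")
proof
  let ?g = "\<lambda>N. \<Sum>k\<le>N. a k *\<^sub>C (T ^^ k) f"
  {
    assume ?lhs
    show ?rhs
    proof (intro allI ell2_eqI)
      fix n u
      \<comment> \<open>Coefficient \<open>n\<close> at \<open>u\<close> sees \<open>g\<close> only
        down to this depth, where \<open>g\<close> equals the partial sum; and
        \<open>n \<le> ?N\<close> gives the partial sum the right coefficient.\<close>
      let ?N = "depth E u + n"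
      have "Rep_ell2 (model_coeff T (g - ?g ?N) n) u = 0"
        by (rule model_coeff_eq_0_local)
          (simp add: \<open>?lhs\<close> minus_ell2.rep_eq Rep_partial_sum del: sum.atMost_Suc)
      then show "Rep_ell2 (model_coeff T g n) u = Rep_ell2 (\<Sum>k\<le>n. a k *\<^sub>C model_coeff T f (n - k)) u"
        by (simp add: linear_diff[OF linear_model_coeff] model_coeff_partial_sum minus_ell2.rep_eq)
    qed
  next
    assume ?rhs
    show ?lhs
    proof
      fix v
      \<comment> \<open>Truncating at the depth of \<open>v\<close> serves twice: the coefficients
        up to that index agree, and at \<open>v\<close> the partial sum already is the
        multiplier.\<close>
      have "Rep_ell2 (g - ?g (depth E v)) v = 0"
        by (rule eq_0_if_model_coeff_eq_0)
          (simp add: linear_diff[OF linear_model_coeff] model_coeff_partial_sum \<open>?rhs\<close>)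
      then show "Rep_ell2 g v = mult_fun E lam a (Rep_ell2 f) v"
        by (simp add: minus_ell2.rep_eq Rep_partial_sum)
    qed
  }
qed

text \<open>The restriction to the kernel does no harm, since all coefficients lie there; both sides
  then state the same convolution identity.\<close>

lemma gmult_rel_iff:
  "gmult_rel T (\<lambda>n. \<lambda>f\<in>ker (cadjoint T). a n *\<^sub>C f) (model_map T f) (model_map T g) \<longleftrightarrow>
    Rep_ell2 g = mult_fun E lam a (Rep_ell2 f)"
  by (simp add: gmult_rel_def model_space_def mult_fun_iff_model_coeff model_coeff_in_ker)

end

lemma scaleC_restrict_in_bounded_operators:
  assumes "bounded_clinear S"
  shows "(\<lambda>f\<in>ker S. c *\<^sub>C f) \<in> bounded_operators (ker S)"
proof -
  have "f + g \<in> ker S" "d *\<^sub>C f \<in> ker S" if "f \<in> ker S" "g \<in> ker S" for f g d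
    using that by (simp_all add: ker_def linear_add[OF bounded_clinear_linear[OF assms]]
        bounded_clinear_scaleC[OF assms])
  then show ?thesis
    unfolding bounded_operators_def
    by (auto simp: scaleC_add_right mult.commute norm_scaleC intro!: exI[of _ "cmod c"])
qed

theorem proposition16:
  fixes E :: "('v \<times> 'v) set"
    and lam :: "'v \<Rightarrow> real"
    and a \<phi> :: "nat \<Rightarrow> complex"
    and \<psi> :: "nat \<Rightarrow> 'v ell2 \<Rightarrow> 'v ell2"
  assumes "countable (UNIV :: 'v set)" and "infinite (UNIV :: 'v set)"
    and "rooted_directed_tree E" and "leafless E"
    and "\<And>v. v \<noteq> tree_root E \<Longrightarrow> lam v > 0"
    and "wshift_dom E lam = UNIV" and "bounded_clinear (wshift E lam)"
    and "left_invertible (wshift E lam)"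
    and "\<And>n. \<phi> n = a n"
    and "\<And>n. \<psi> n = (\<lambda>f\<in>ker (cadjoint (wshift E lam)). a n *\<^sub>C f)"
  shows "(multiplier E lam \<phi> \<longleftrightarrow> generalized_multiplier (wshift E lam) \<psi>) \<and>
    (multiplier E lam \<phi> \<and> generalized_multiplier (wshift E lam) \<psi> \<longrightarrow>
       mult_op E lam \<phi> =
         model_map_adj (wshift E lam) \<circ> gmult_op (wshift E lam) \<psi> \<circ> model_map (wshift E lam))"
proof -
  interpret left_invertible_wshift E lam
    using assms by unfold_locales
  have \<phi>: "\<phi> = a" and \<psi>: "\<psi> = (\<lambda>n. \<lambda>f\<in>ker (cadjoint T). a n *\<^sub>C f)"
    using assms by auto
  \<comment> \<open>Every member of the model space is some \<open>model_map T g\<close>, which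
    carries the relation back to square-summable functions.\<close>
  have rel: "gmult_rel T \<psi> (model_map T f) G \<longleftrightarrow>
      (\<exists>g. G = model_map T g \<and> Rep_ell2 g = mult_fun E lam \<phi> (Rep_ell2 f))" for f G
  proof
    assume rel: "gmult_rel T \<psi> (model_map T f) G"
    then obtain g where "G = model_map T g"
      by (auto simp: gmult_rel_def model_space_def)
    with rel show "\<exists>g. G = model_map T g \<and> Rep_ell2 g = mult_fun E lam \<phi> (Rep_ell2 f)"
      unfolding \<phi> \<psi> by (auto simp: gmult_rel_iff)
  next
    assume "\<exists>g. G = model_map T g \<and> Rep_ell2 g = mult_fun E lam \<phi> (Rep_ell2 f)"
    then show "gmult_rel T \<psi> (model_map T f) G"
      unfolding \<phi> \<psi> by (auto simp: gmult_rel_iff)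
  qed
  \<comment> \<open>Square-summability is recast as existence of a vector, the form that
    \<open>gmult_dom\<close> has.\<close>
  have mult_dom_iff: "f \<in> mult_dom E lam \<phi> \<longleftrightarrow> (\<exists>g. Rep_ell2 g = mult_fun E lam \<phi> (Rep_ell2 f))" for f
  proof
    assume "f \<in> mult_dom E lam \<phi>"
    then have "Rep_ell2 (Abs_ell2 (mult_fun E lam \<phi> (Rep_ell2 f))) = mult_fun E lam \<phi> (Rep_ell2 f)"
      by (intro Abs_ell2_inverse) (simp add: mult_dom_def)
    then show "\<exists>g. Rep_ell2 g = mult_fun E lam \<phi> (Rep_ell2 f)" ..
  next
    assume "\<exists>g. Rep_ell2 g = mult_fun E lam \<phi> (Rep_ell2 f)"
    then obtain g where "Rep_ell2 g = mult_fun E lam \<phi> (Rep_ell2 f)" ..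
    then show "f \<in> mult_dom E lam \<phi>"
      using square_summable_Rep_ell2[of g] by (simp add: mult_dom_def)
  qed
  have "gmult_dom T \<psi> \<subseteq> model_space T"
    by (auto simp: gmult_dom_def gmult_rel_def)
  moreover have "model_map T f \<in> gmult_dom T \<psi> \<longleftrightarrow> f \<in> mult_dom E lam \<phi>" for f
    unfolding gmult_dom_def mult_dom_iff mem_Collect_eq rel by blast
  ultimately have "gmult_dom T \<psi> = model_space T \<longleftrightarrow> mult_dom E lam \<phi> = UNIV"
    unfolding model_space_def by blast
  moreover have "\<psi> n \<in> bounded_operators (ker (cadjoint T))" for n
    unfolding \<psi> by (intro scaleC_restrict_in_bounded_operators bounded_clinear_cadjoint bounded_T)
  ultimately have iff: "multiplier E lam \<phi> \<longleftrightarrow> generalized_multiplier T \<psi>"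
    by (simp add: multiplier_def generalized_multiplier_def)
  have "mult_op E lam \<phi> f = model_map_adj T (gmult_op T \<psi> (model_map T f))"
    if "multiplier E lam \<phi>" for f
  proof -
    have "f \<in> mult_dom E lam \<phi>"
      using that by (simp add: multiplier_def)
    then obtain g where g: "Rep_ell2 g = mult_fun E lam \<phi> (Rep_ell2 f)"
      unfolding mult_dom_iff ..
    \<comment> \<open>The description is definite because \<open>Rep_ell2\<close> is
      injective.\<close>
    have "gmult_op T \<psi> (model_map T f) = model_map T g"
      unfolding gmult_op_def rel g[symmetric] by (intro the_equality) (auto simp: Rep_ell2_inject)
    moreover have "mult_op E lam \<phi> f = g"
      by (simp add: mult_op_def Rep_ell2_inverse flip: g)
    ultimately show ?thesis by simp
  qed
  then have "mult_op E lam \<phi> = model_map_adj T \<circ> gmult_op T \<psi> \<circ> model_map T"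
    if "multiplier E lam \<phi>"
    using that by (intro ext) simp
  with iff show ?thesis by metis
qed

end
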